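(* Let $n\ge 1$, let $T_1,\dots,T_n$ be metric trees, and let $\Pi=T_1\times\dots\times T_n$ be their product, equipped with the metric $|p-q|_\Pi=\bigl(\sum_{i=1}^n|p_i-q_i|_{T_i}^2\bigr)^{1/2}$ for $p=(p_1,\dots,p_n)$ and $q=(q_1,\dots,q_n)$ in $\Pi$. Then $\Pi$ meets the $O_3$-comparison; that is, for any six points $x,x',y,y',z,z'\in\Pi$ (not necessarily distinct) there are points $\tilde x,\tilde x',\tilde y,\tilde y',\tilde z,\tilde z'$ in the Hilbert space $\mathbb{H}$ such that $$|\tilde x-\tilde x'|_{\mathbb{H}}\ge|x-x'|_\Pi,\qquad |\tilde y-\tilde y'|_{\mathbb{H}}\ge|y-y'|_\Pi,\qquad |\tilde z-\tilde z'|_{\mathbb{H}}\ge|z-z'|_\Pi,$$ and $|\tilde p-\tilde q|_{\mathbb{H}}\le|p-q|_\Pi$ for each of the remaining twelve pairs of labels $\{p,q\}\subset\{x,x',y,y',z,z'\}$, that is, all pairs of distinct labels other than $\{x,x'\}$, $\{y,y'\}$, $\{z,z'\}$.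
   Context: $|p-q|_M$ denotes the distance between points $p$ and $q$ in a metric space $M$. $\mathbb{H}$ denotes the (infinite-dimensional, real, separable) Hilbert space, for example $\ell^2$. A geodesic from $x$ to $y$ in a metric space is (the image of) a distance-preserving map of a closed real interval of length equal to the distance from $x$ to $y$, with endpoints mapped to $x$ and $y$. A geodesic space is a metric space in which any two points are connected by a geodesic. A metric tree is a geodesic space such that any two points $x$ and $y$ are connected by a unique geodesic, denoted $[xy]$, and the union of any two geodesics $[xy]$ and $[yz]$ contains the geodesic $[xz]$. Graph comparison: let $\Gamma$ be a graph with vertices $v_1,\dots,v_m$. A metric space $X$ meets the $\Gamma$-comparison if for any points in $X$ labeled by the vertices of $\Gamma$ (again denoted $v_1,\dots,v_m$) there are points $\tilde v_1,\dots,\tilde v_m\in\mathbb{H}$ such that for all $i\ne j$: if $v_i$ is adjacent to $v_j$ in $\Gamma$, then $|\tilde v_i-\tilde v_j|_{\mathbb{H}}\le|v_i-v_j|_X$; otherwise $|\tilde v_i-\tilde v_j|_{\mathbb{H}}\ge|v_i-v_j|_X$. $O_3$ denotes the graph of the octahedron: it has six vertices, labeled $x,x',y,y',z,z'$, and every two distinct vertices are adjacent except for the three opposite pairs $\{x,x'\}$, $\{y,y'\}$, $\{z,z'\}$. *)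

theory Defs
  imports "HOL-Analysis.Analysis"
begin

section \<open>The Hilbert space of square-summable real sequences\<close>

typedef ell2 = "{f :: nat \<Rightarrow> real. summable (\<lambda>n. (f n)\<^sup>2)}"
  morphisms ell2_nth Abs_ell2
  by (rule exI[of _ "\<lambda>_. 0"]) simp

setup_lifting type_definition_ell2

lemma summable_ell2_mult:
  fixes f g :: "nat \<Rightarrow> real"
  assumes "summable (\<lambda>n. (f n)\<^sup>2)" "summable (\<lambda>n. (g n)\<^sup>2)"
  shows "summable (\<lambda>n. f n * g n)"
proof (rule summable_comparison_test')
  show "summable (\<lambda>n. (f n)\<^sup>2 + (g n)\<^sup>2)"
    using assms by (rule summable_add)
next
  fix n :: nat
  have "2 * (\<bar>f n\<bar> * \<bar>g n\<bar>) \<le> (f n)\<^sup>2 + (g n)\<^sup>2"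
    using sum_squares_bound[of "\<bar>f n\<bar>" "\<bar>g n\<bar>"] by (simp add: mult.assoc)
  moreover have "0 \<le> \<bar>f n\<bar> * \<bar>g n\<bar>" by simp
  ultimately have "\<bar>f n\<bar> * \<bar>g n\<bar> \<le> (f n)\<^sup>2 + (g n)\<^sup>2" by linarith
  then show "norm (f n * g n) \<le> (f n)\<^sup>2 + (g n)\<^sup>2"
    by (simp add: abs_mult)
qed

lemma summable_ell2_add:
  fixes f g :: "nat \<Rightarrow> real"
  assumes "summable (\<lambda>n. (f n)\<^sup>2)" "summable (\<lambda>n. (g n)\<^sup>2)"
  shows "summable (\<lambda>n. (f n + g n)\<^sup>2)"
proof -
  have "summable (\<lambda>n. (f n)\<^sup>2 + (g n)\<^sup>2 + 2 * (f n * g n))"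
    using assms summable_ell2_mult[OF assms] by (intro summable_add summable_mult)
  then show ?thesis by (simp add: power2_sum mult.assoc)
qed

instantiation ell2 :: real_inner
begin

lift_definition zero_ell2 :: ell2 is "\<lambda>_. 0" by simp

lift_definition plus_ell2 :: "ell2 \<Rightarrow> ell2 \<Rightarrow> ell2" is "\<lambda>f g n. f n + g n"
  by (rule summable_ell2_add)

lift_definition uminus_ell2 :: "ell2 \<Rightarrow> ell2" is "\<lambda>f n. - f n" by simp

lift_definition minus_ell2 :: "ell2 \<Rightarrow> ell2 \<Rightarrow> ell2" is "\<lambda>f g n. f n - g n"
  subgoal for f g using summable_ell2_add[of f "\<lambda>n. - g n"] by simp
  done

lift_definition scaleR_ell2 :: "real \<Rightarrow> ell2 \<Rightarrow> ell2" is "\<lambda>c f n. c * f n"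
  by (simp add: power_mult_distrib summable_mult)

lift_definition inner_ell2 :: "ell2 \<Rightarrow> ell2 \<Rightarrow> real" is "\<lambda>f g. \<Sum>n. f n * g n" .

definition norm_ell2 :: "ell2 \<Rightarrow> real" where
  "norm_ell2 x = sqrt (inner x x)"

definition sgn_ell2 :: "ell2 \<Rightarrow> ell2" where
  "sgn_ell2 x = inverse (norm x) *\<^sub>R x"

definition dist_ell2 :: "ell2 \<Rightarrow> ell2 \<Rightarrow> real" where
  "dist_ell2 x y = norm (x - y)"

definition uniformity_ell2 :: "(ell2 \<times> ell2) filter" where
  "uniformity_ell2 = (INF e\<in>{0 <..}. principal {(x, y). dist x y < e})"

definition open_ell2 :: "ell2 set \<Rightarrow> bool" where
  "open_ell2 U \<longleftrightarrow> (\<forall>x\<in>U. eventually (\<lambda>(x', y). x' = x \<longrightarrow> y \<in> U) uniformity)"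

instance
proof
  fix x y z :: ell2 and a b :: real
  show "x + y + z = x + (y + z)" by transfer (simp add: add.assoc)
  show "x + y = y + x" by transfer (simp add: add.commute)
  show "0 + x = x" by transfer simp
  show "- x + x = 0" by transfer simp
  show "x - y = x + - y" by transfer simp
  show "a *\<^sub>R (x + y) = a *\<^sub>R x + a *\<^sub>R y" by transfer (simp add: distrib_left)
  show "(a + b) *\<^sub>R x = a *\<^sub>R x + b *\<^sub>R x" by transfer (simp add: distrib_right)
  show "a *\<^sub>R b *\<^sub>R x = (a * b) *\<^sub>R x" by transfer (simp add: mult.assoc)
  show "1 *\<^sub>R x = x" by transfer simp
  show "sgn x = inverse (norm x) *\<^sub>R x" by (rule sgn_ell2_def)
  show "dist x y = norm (x - y)" by (rule dist_ell2_def)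
  show "uniformity = (INF e\<in>{0 <..}. principal {(x :: ell2, y). dist x y < e})"
    by (rule uniformity_ell2_def)
  show "open U \<longleftrightarrow> (\<forall>x\<in>U. eventually (\<lambda>(x', y). x' = x \<longrightarrow> y \<in> U) uniformity)"
    for U :: "ell2 set" by (rule open_ell2_def)
  show "inner x y = inner y x" by transfer (simp add: mult.commute)
  show "inner (x + y) z = inner x z + inner y z"
    by transfer (simp add: distrib_right suminf_add summable_ell2_mult)
  show "inner (a *\<^sub>R x) y = a * inner x y"
    by transfer (simp add: mult.assoc suminf_mult summable_ell2_mult)
  show "0 \<le> inner x x"
    by transfer (simp add: suminf_nonneg power2_eq_square)
  show "inner x x = 0 \<longleftrightarrow> x = 0"
    by transfer (auto simp: suminf_eq_zero_iff power2_eq_square fun_eq_iff)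
  show "norm x = sqrt (inner x x)" by (rule norm_ell2_def)
qed

end

lemma norm_ell2: "norm x = sqrt (\<Sum>n. (ell2_nth x n)\<^sup>2)"
  unfolding norm_ell2_def by transfer (simp add: power2_eq_square)

lemma dist_ell2: "dist x y = sqrt (\<Sum>n. (ell2_nth x n - ell2_nth y n)\<^sup>2)"
  unfolding dist_norm norm_ell2 by transfer simp

lemma sum_ell2_nth_le: "(\<Sum>n<N. (ell2_nth x n)\<^sup>2) \<le> (norm x)\<^sup>2"
proof -
  have s: "summable (\<lambda>n. (ell2_nth x n)\<^sup>2)" using ell2_nth[of x] by simp
  have "(\<Sum>n<N. (ell2_nth x n)\<^sup>2) \<le> (\<Sum>n. (ell2_nth x n)\<^sup>2)"
    by (rule sum_le_suminf[OF s]) auto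
  also have "\<dots> = (norm x)\<^sup>2"
    unfolding norm_ell2 by (simp add: suminf_nonneg s)
  finally show ?thesis .
qed

lemma ell2_nth_minus: "ell2_nth (x - y) n = ell2_nth x n - ell2_nth y n"
  by transfer simp

instance ell2 :: complete_space
proof
  fix X :: "nat \<Rightarrow> ell2"
  assume C: "Cauchy X"
  have nth_le: "\<bar>ell2_nth x n\<bar> \<le> norm x" for x n
  proof -
    have "(ell2_nth x n)\<^sup>2 \<le> (\<Sum>k<Suc n. (ell2_nth x k)\<^sup>2)"
      by (simp add: sum_nonneg)
    also have "\<dots> \<le> (norm x)\<^sup>2" by (rule sum_ell2_nth_le)
    finally show ?thesis using abs_le_square_iff[of "ell2_nth x n" "norm x"] by simp
  qed
  have "Cauchy (\<lambda>k. ell2_nth (X k) n)" for n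
  proof (rule metric_CauchyI)
    fix e :: real assume "e > 0"
    then obtain M where M: "\<And>i j. i \<ge> M \<Longrightarrow> j \<ge> M \<Longrightarrow> dist (X i) (X j) < e"
      using metric_CauchyD[OF C \<open>e > 0\<close>] by blast
    have "dist (ell2_nth (X i) n) (ell2_nth (X j) n) < e" if "i \<ge> M" "j \<ge> M" for i j
      using nth_le[of "X i - X j" n] M[OF that]
      by (simp add: ell2_nth_minus dist_norm)
    then show "\<exists>M. \<forall>m\<ge>M. \<forall>k\<ge>M. dist (ell2_nth (X m) n) (ell2_nth (X k) n) < e" by blast
  qed
  then have "\<exists>l. (\<lambda>k. ell2_nth (X k) n) \<longlonglongrightarrow> l" for n
    using Cauchy_convergent_iff convergent_def by blast
  then obtain l where l: "\<And>n. (\<lambda>k. ell2_nth (X k) n) \<longlonglongrightarrow> l n" by metis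
  have tail: "\<exists>M. \<forall>i\<ge>M. \<forall>N. (\<Sum>n<N. (ell2_nth (X i) n - l n)\<^sup>2) \<le> e\<^sup>2" if "e > 0" for e :: real
  proof -
    obtain M where M: "\<And>i j. i \<ge> M \<Longrightarrow> j \<ge> M \<Longrightarrow> dist (X i) (X j) < e"
      using metric_CauchyD[OF C \<open>e > 0\<close>] by blast
    have "(\<Sum>n<N. (ell2_nth (X i) n - l n)\<^sup>2) \<le> e\<^sup>2" if "i \<ge> M" for i N
    proof (rule LIMSEQ_le_const2)
      show "(\<lambda>j. \<Sum>n<N. (ell2_nth (X i) n - ell2_nth (X j) n)\<^sup>2)
              \<longlonglongrightarrow> (\<Sum>n<N. (ell2_nth (X i) n - l n)\<^sup>2)"
        by (intro tendsto_intros l)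
      have "(\<Sum>n<N. (ell2_nth (X i) n - ell2_nth (X j) n)\<^sup>2) \<le> e\<^sup>2" if "j \<ge> M" for j
      proof -
        have "(\<Sum>n<N. (ell2_nth (X i) n - ell2_nth (X j) n)\<^sup>2) \<le> (norm (X i - X j))\<^sup>2"
          using sum_ell2_nth_le[where x = "X i - X j"] by (simp add: ell2_nth_minus)
        also have "\<dots> \<le> e\<^sup>2"
          using M[OF \<open>i \<ge> M\<close> that] by (intro power_mono) (auto simp: dist_norm)
        finally show ?thesis .
      qed
      then show "\<exists>M. \<forall>j\<ge>M. (\<Sum>n<N. (ell2_nth (X i) n - ell2_nth (X j) n)\<^sup>2) \<le> e\<^sup>2" by blast
    qed
    then show ?thesis by blast
  qed
  have sm: "summable (\<lambda>n. (ell2_nth (X i) n - l n)\<^sup>2) \<and> (\<Sum>n. (ell2_nth (X i) n - l n)\<^sup>2) \<le> B"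
    if "\<And>N. (\<Sum>n<N. (ell2_nth (X i) n - l n)\<^sup>2) \<le> B" for i B
  proof -
    have "summable (\<lambda>n. (ell2_nth (X i) n - l n)\<^sup>2)"
      by (rule summableI_nonneg_bounded[where x = B]) (auto simp: that)
    then show ?thesis using that by (auto intro: suminf_le_const)
  qed
  obtain M1 where "\<forall>N. (\<Sum>n<N. (ell2_nth (X M1) n - l n)\<^sup>2) \<le> 1\<^sup>2"
    using tail[of 1] by auto
  then have "summable (\<lambda>n. (ell2_nth (X M1) n - l n)\<^sup>2)" using sm by blast
  then have "summable (\<lambda>n. (l n - ell2_nth (X M1) n)\<^sup>2)" by (simp add: power2_commute)
  then have "summable (\<lambda>n. (l n - ell2_nth (X M1) n + ell2_nth (X M1) n)\<^sup>2)"
    using ell2_nth[of "X M1"] by (intro summable_ell2_add) auto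
  then have L: "ell2_nth (Abs_ell2 l) = l" by (simp add: Abs_ell2_inverse)
  have "X \<longlonglongrightarrow> Abs_ell2 l"
  proof (rule metric_LIMSEQ_I)
    fix e :: real assume "e > 0"
    then obtain M where M: "\<forall>i\<ge>M. \<forall>N. (\<Sum>n<N. (ell2_nth (X i) n - l n)\<^sup>2) \<le> (e/2)\<^sup>2"
      using tail[of "e/2"] by auto
    have "dist (X i) (Abs_ell2 l) < e" if "i \<ge> M" for i
    proof -
      have "(\<Sum>n. (ell2_nth (X i) n - l n)\<^sup>2) \<le> (e/2)\<^sup>2" using sm M that by blast
      then have "dist (X i) (Abs_ell2 l) \<le> sqrt ((e/2)\<^sup>2)" by (simp only: dist_ell2 L real_sqrt_le_iff)
      also have "\<dots> < e" using \<open>e > 0\<close> by simp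
      finally show ?thesis .
    qed
    then show "\<exists>M. \<forall>i\<ge>M. dist (X i) (Abs_ell2 l) < e" by blast
  qed
  then show "convergent X" by (auto simp: convergent_def)
qed


section \<open>Metric trees\<close>

text \<open>Geodesics are identified with their images.\<close>

definition is_geodesic :: "'a metric \<Rightarrow> 'a \<Rightarrow> 'a \<Rightarrow> 'a set \<Rightarrow> bool" where
  "is_geodesic X x y S \<longleftrightarrow>
     (\<exists>(\<gamma> :: real \<Rightarrow> 'a) a b.
        a \<le> b \<and> b - a = mdist X x y \<and>
        \<gamma> \<in> {a..b} \<rightarrow> mspace X \<and>
        (\<forall>s\<in>{a..b}. \<forall>t\<in>{a..b}. mdist X (\<gamma> s) (\<gamma> t) = dist s t) \<and>
        \<gamma> a = x \<and> \<gamma> b = y \<and> S = \<gamma> ` {a..b})"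

definition geodesic_space :: "'a metric \<Rightarrow> bool" where
  "geodesic_space X \<longleftrightarrow> (\<forall>x\<in>mspace X. \<forall>y\<in>mspace X. \<exists>S. is_geodesic X x y S)"

definition geodesic_segment :: "'a metric \<Rightarrow> 'a \<Rightarrow> 'a \<Rightarrow> 'a set" where
  "geodesic_segment X x y = (THE S. is_geodesic X x y S)"

definition metric_tree :: "'a metric \<Rightarrow> bool" where
  "metric_tree X \<longleftrightarrow>
     geodesic_space X \<and>
     (\<forall>x\<in>mspace X. \<forall>y\<in>mspace X. \<exists>!S. is_geodesic X x y S) \<and>
     (\<forall>x\<in>mspace X. \<forall>y\<in>mspace X. \<forall>z\<in>mspace X.
        geodesic_segment X x z \<subseteq> geodesic_segment X x y \<union> geodesic_segment X y z)"


section \<open>Finite products of metric spaces\<close>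

definition l2_product :: "'i set \<Rightarrow> ('i \<Rightarrow> 'a metric) \<Rightarrow> ('i \<Rightarrow> 'a) metric" where
  "l2_product I T =
     metric (\<Pi>\<^sub>E i\<in>I. mspace (T i), \<lambda>p q. sqrt (\<Sum>i\<in>I. (mdist (T i) (p i) (q i))\<^sup>2))"

text \<open>The projections of \<^term>\<open>metric (M, d)\<close> are \<^term>\<open>M\<close> and \<^term>\<open>d\<close> only if these form a
  metric space, which requires the index set to be finite here.\<close>

lemma Metric_space_l2_product:
  assumes "finite I"
  shows "Metric_space (\<Pi>\<^sub>E i\<in>I. mspace (T i))
           (\<lambda>p q. sqrt (\<Sum>i\<in>I. (mdist (T i) (p i) (q i))\<^sup>2))"
proof
  fix p q r :: "'a \<Rightarrow> 'b"
  show "0 \<le> sqrt (\<Sum>i\<in>I. (mdist (T i) (p i) (q i))\<^sup>2)" by (simp add: sum_nonneg)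
  show "sqrt (\<Sum>i\<in>I. (mdist (T i) (p i) (q i))\<^sup>2) = sqrt (\<Sum>i\<in>I. (mdist (T i) (q i) (p i))\<^sup>2)"
    by (simp add: mdist_commute)
  assume p: "p \<in> (\<Pi>\<^sub>E i\<in>I. mspace (T i))" and q: "q \<in> (\<Pi>\<^sub>E i\<in>I. mspace (T i))"
  have "(\<Sum>i\<in>I. (mdist (T i) (p i) (q i))\<^sup>2) = 0 \<longleftrightarrow> (\<forall>i\<in>I. mdist (T i) (p i) (q i) = 0)"
    using assms by (simp add: sum_nonneg_eq_0_iff)
  also have "\<dots> \<longleftrightarrow> (\<forall>i\<in>I. p i = q i)"
    using p q by (intro ball_cong) (auto simp: PiE_iff)
  also have "\<dots> \<longleftrightarrow> p = q"
    using p q by (auto intro: PiE_ext)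
  finally show "sqrt (\<Sum>i\<in>I. (mdist (T i) (p i) (q i))\<^sup>2) = 0 \<longleftrightarrow> p = q" by simp
  assume r: "r \<in> (\<Pi>\<^sub>E i\<in>I. mspace (T i))"
  have "L2_set (\<lambda>i. mdist (T i) (p i) (r i)) I
          \<le> L2_set (\<lambda>i. mdist (T i) (p i) (q i) + mdist (T i) (q i) (r i)) I"
    using p q r by (intro L2_set_mono mdist_triangle) (auto simp: PiE_iff)
  also have "\<dots> \<le> L2_set (\<lambda>i. mdist (T i) (p i) (q i)) I + L2_set (\<lambda>i. mdist (T i) (q i) (r i)) I"
    by (rule L2_set_triangle_ineq)
  finally show "sqrt (\<Sum>i\<in>I. (mdist (T i) (p i) (r i))\<^sup>2)
      \<le> sqrt (\<Sum>i\<in>I. (mdist (T i) (p i) (q i))\<^sup>2) + sqrt (\<Sum>i\<in>I. (mdist (T i) (q i) (r i))\<^sup>2)"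
    by (simp add: L2_set_def)
qed

lemma mspace_l2_product [simp]:
  "finite I \<Longrightarrow> mspace (l2_product I T) = (\<Pi>\<^sub>E i\<in>I. mspace (T i))"
  by (simp add: l2_product_def Metric_space.mspace_metric Metric_space_l2_product)

lemma mdist_l2_product [simp]:
  "finite I \<Longrightarrow> mdist (l2_product I T) p q = sqrt (\<Sum>i\<in>I. (mdist (T i) (p i) (q i))\<^sup>2)"
  by (simp add: l2_product_def Metric_space.mdist_metric Metric_space_l2_product)


section \<open>Graph comparison\<close>

text \<open>A graph is given by its vertex set and its set of edges, an edge being the set of its two
  endpoints.\<close>

definition meets_comparison :: "'v set \<Rightarrow> 'v set set \<Rightarrow> 'a metric \<Rightarrow> bool" where
  "meets_comparison V E X \<longleftrightarrow>
     (\<forall>v \<in> V \<rightarrow> mspace X. \<exists>w :: 'v \<Rightarrow> ell2. \<forall>i\<in>V. \<forall>j\<in>V. i \<noteq> j \<longrightarrow>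
        (if {i, j} \<in> E then dist (w i) (w j) \<le> mdist X (v i) (v j)
         else dist (w i) (w j) \<ge> mdist X (v i) (v j)))"

datatype octahedron_vertex = vx | vx' | vy | vy' | vz | vz'

definition octahedron_edges :: "octahedron_vertex set set" where
  "octahedron_edges = {{i, j} |i j. i \<noteq> j} - {{vx, vx'}, {vy, vy'}, {vz, vz'}}"

definition meets_O3_comparison :: "'a metric \<Rightarrow> bool" where
  "meets_O3_comparison X \<longleftrightarrow> meets_comparison UNIV octahedron_edges X"

lemma meets_O3_comparison_iff:
  "meets_O3_comparison X \<longleftrightarrow>
     (\<forall>x\<in>mspace X. \<forall>x'\<in>mspace X. \<forall>y\<in>mspace X. \<forall>y'\<in>mspace X. \<forall>z\<in>mspace X. \<forall>z'\<in>mspace X.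
        \<exists>x1 x1' y1 y1' z1 z1' :: ell2.
          dist x1 x1' \<ge> mdist X x x' \<and> dist y1 y1' \<ge> mdist X y y' \<and> dist z1 z1' \<ge> mdist X z z' \<and>
          dist x1 y1 \<le> mdist X x y \<and> dist x1 y1' \<le> mdist X x y' \<and> dist x1 z1 \<le> mdist X x z \<and>
          dist x1 z1' \<le> mdist X x z' \<and> dist x1' y1 \<le> mdist X x' y \<and> dist x1' y1' \<le> mdist X x' y' \<and>
          dist x1' z1 \<le> mdist X x' z \<and> dist x1' z1' \<le> mdist X x' z' \<and> dist y1 z1 \<le> mdist X y z \<and>
          dist y1 z1' \<le> mdist X y z' \<and> dist y1' z1 \<le> mdist X y' z \<and> dist y1' z1' \<le> mdist X y' z')"
  (is "_ \<longleftrightarrow> ?R")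
proof -
  have all: "(\<forall>i. P i) \<longleftrightarrow> P vx \<and> P vx' \<and> P vy \<and> P vy' \<and> P vz \<and> P vz'" for P
    by (metis octahedron_vertex.exhaust)
  have edge: "{i, j} \<in> octahedron_edges \<longleftrightarrow>
      i \<noteq> j \<and> {i, j} \<noteq> {vx, vx'} \<and> {i, j} \<noteq> {vy, vy'} \<and> {i, j} \<noteq> {vz, vz'}" for i j
    by (auto simp: octahedron_edges_def doubleton_eq_iff)
  let ?f = "\<lambda>a a' b b' c c'. case_octahedron_vertex a a' b b' c c'"
  show ?thesis
  proof
    assume L: "meets_O3_comparison X"
    show ?R
    proof (intro ballI)
      fix x x' y y' z z'
      assume "x \<in> mspace X" "x' \<in> mspace X" "y \<in> mspace X" "y' \<in> mspace X"
        "z \<in> mspace X" "z' \<in> mspace X"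
      then have "?f x x' y y' z z' \<in> UNIV \<rightarrow> mspace X"
        by (auto simp: Pi_iff all)
      from bspec[OF L[unfolded meets_O3_comparison_def meets_comparison_def] this]
      obtain w :: "octahedron_vertex \<Rightarrow> ell2" where w: "\<forall>i\<in>UNIV. \<forall>j\<in>UNIV. i \<noteq> j \<longrightarrow>
        (if {i, j} \<in> octahedron_edges
         then dist (w i) (w j) \<le> mdist X (?f x x' y y' z z' i) (?f x x' y y' z z' j)
         else dist (w i) (w j) \<ge> mdist X (?f x x' y y' z z' i) (?f x x' y y' z z' j))" by blast
      show "\<exists>x1 x1' y1 y1' z1 z1' :: ell2.
          dist x1 x1' \<ge> mdist X x x' \<and> dist y1 y1' \<ge> mdist X y y' \<and> dist z1 z1' \<ge> mdist X z z' \<and>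
          dist x1 y1 \<le> mdist X x y \<and> dist x1 y1' \<le> mdist X x y' \<and> dist x1 z1 \<le> mdist X x z \<and>
          dist x1 z1' \<le> mdist X x z' \<and> dist x1' y1 \<le> mdist X x' y \<and> dist x1' y1' \<le> mdist X x' y' \<and>
          dist x1' z1 \<le> mdist X x' z \<and> dist x1' z1' \<le> mdist X x' z' \<and> dist y1 z1 \<le> mdist X y z \<and>
          dist y1 z1' \<le> mdist X y z' \<and> dist y1' z1 \<le> mdist X y' z \<and> dist y1' z1' \<le> mdist X y' z'"
        by (rule exI[of _ "w vx"], rule exI[of _ "w vx'"], rule exI[of _ "w vy"],
            rule exI[of _ "w vy'"], rule exI[of _ "w vz"], rule exI[of _ "w vz'"])
          (use w in \<open>simp add: all edge doubleton_eq_iff\<close>)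
    qed
  next
    assume R: ?R
    show "meets_O3_comparison X"
      unfolding meets_O3_comparison_def meets_comparison_def
    proof
      fix v :: "octahedron_vertex \<Rightarrow> 'a" assume "v \<in> UNIV \<rightarrow> mspace X"
      then have v: "v i \<in> mspace X" for i by auto
      obtain x1 x1' y1 y1' z1 z1' :: ell2 where w:
         "dist x1 x1' \<ge> mdist X (v vx) (v vx') \<and> dist y1 y1' \<ge> mdist X (v vy) (v vy') \<and> dist z1 z1' \<ge> mdist X (v vz) (v vz') \<and>
          dist x1 y1 \<le> mdist X (v vx) (v vy) \<and> dist x1 y1' \<le> mdist X (v vx) (v vy') \<and> dist x1 z1 \<le> mdist X (v vx) (v vz) \<and>
          dist x1 z1' \<le> mdist X (v vx) (v vz') \<and> dist x1' y1 \<le> mdist X (v vx') (v vy) \<and> dist x1' y1' \<le> mdist X (v vx') (v vy') \<and>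
          dist x1' z1 \<le> mdist X (v vx') (v vz) \<and> dist x1' z1' \<le> mdist X (v vx') (v vz') \<and> dist y1 z1 \<le> mdist X (v vy) (v vz) \<and>
          dist y1 z1' \<le> mdist X (v vy) (v vz') \<and> dist y1' z1 \<le> mdist X (v vy') (v vz) \<and> dist y1' z1' \<le> mdist X (v vy') (v vz')"
        using R[rule_format, OF v[of vx] v[of vx'] v[of vy] v[of vy'] v[of vz] v[of vz']] by blast
      show "\<exists>w :: octahedron_vertex \<Rightarrow> ell2. \<forall>i\<in>UNIV. \<forall>j\<in>UNIV. i \<noteq> j \<longrightarrow>
        (if {i, j} \<in> octahedron_edges then dist (w i) (w j) \<le> mdist X (v i) (v j)
         else dist (w i) (w j) \<ge> mdist X (v i) (v j))"
        by (rule exI[of _ "?f x1 x1' y1 y1' z1 z1'"])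
          (use w in \<open>simp add: all edge doubleton_eq_iff dist_commute mdist_commute\<close>)
    qed
  qed
qed

end

theory Submission
  imports Defs
begin

text \<open>Squared distances add up in orthogonal sums, so it suffices to place six points of a single tree
  in the plane. If the geodesics \<open>[xx']\<close>, \<open>[yy']\<close>, \<open>[zz']\<close> can be oriented consistently along their
  pairwise overlaps, then some \<open>1\<close>-Lipschitz function to the line preserves the three distances of the
  opposite pairs. Otherwise the three geodesics are the three passages of a tripod with legs
  \<open>\<alpha>\<close>, \<open>\<beta>\<close>, \<open>\<gamma>\<close>; the tripod is replaced by a triangle with sides \<open>\<alpha> + \<beta>\<close>, \<open>\<beta> + \<gamma>\<close>, \<open>\<gamma> + \<alpha>\<close>, and
  each of the three sides is extended beyond its ends by the pendant edges of the pair of points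
  that it connects. The opposite pairs keep their distances, and all other distances do not increase
  by the triangle inequality. In both cases only the four-point condition of the tree is used.\<close>

section \<open>The four-point condition in metric trees\<close>

text \<open>In a tree this is the length of the common initial part of the geodesics from
  \<open>x\<close> to \<open>y\<close> and from \<open>x\<close> to \<open>z\<close>.\<close>

definition gromov_product :: "'a metric \<Rightarrow> 'a \<Rightarrow> 'a \<Rightarrow> 'a \<Rightarrow> real" where
  "gromov_product X x y z = (mdist X x y + mdist X x z - mdist X y z) / 2"

lemma gromov_product_nonneg:
  assumes "x \<in> mspace X" "y \<in> mspace X" "z \<in> mspace X"
  shows "0 \<le> gromov_product X x y z"
  using mdist_triangle[of y X x z] assms by (simp add: gromov_product_def mdist_commute)

lemma is_geodesic_dist_add:
  assumes "is_geodesic X x y S" and "p \<in> S"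
  shows "mdist X x p + mdist X p y = mdist X x y"
proof -
  obtain \<gamma> a b t where g: "a \<le> b" "b - a = mdist X x y"
      "\<forall>s\<in>{a..b}. \<forall>t\<in>{a..b}. mdist X (\<gamma> s) (\<gamma> t) = dist s t"
      "\<gamma> a = x" "\<gamma> b = y" and t: "t \<in> {a..b}" "p = \<gamma> t"
    using assms unfolding is_geodesic_def by blast
  have "mdist X (\<gamma> a) (\<gamma> t) = dist a t" "mdist X (\<gamma> t) (\<gamma> b) = dist t b"
    using g(1,3) t(1) by auto
  then show ?thesis using g t by (simp add: dist_real_def)
qed

lemma metric_tree_geodesic:
  assumes "metric_tree X" "x \<in> mspace X" "y \<in> mspace X"
  shows "is_geodesic X x y (geodesic_segment X x y)"
proof -
  have "\<exists>!S. is_geodesic X x y S"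
    using assms by (simp add: metric_tree_def)
  then show ?thesis
    unfolding geodesic_segment_def by (rule theI')
qed

text \<open>Here \<open>p\<close> is the branch point of the tripod spanned by \<open>x\<close>,
  \<open>y\<close>, \<open>z\<close>. The tree axiom puts it on \<open>[xy]\<close> or on
  \<open>[yz]\<close>; additivity of distances along that geodesic and along \<open>[xz]\<close>
  then determines its distance to \<open>y\<close>.\<close>

lemma metric_tree_dist_to_geodesic:
  assumes X: "metric_tree X" and mem: "x \<in> mspace X" "y \<in> mspace X" "z \<in> mspace X"
    and p: "p \<in> geodesic_segment X x z"
    and xp: "mdist X x p = gromov_product X x y z"
  shows "mdist X p y = gromov_product X y x z"
proof -
  have "p \<in> geodesic_segment X x y \<union> geodesic_segment X y z"
    using X mem p unfolding metric_tree_def by blast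
  then have "mdist X x p + mdist X p y = mdist X x y \<or> mdist X y p + mdist X p z = mdist X y z"
    using is_geodesic_dist_add[OF metric_tree_geodesic[OF X mem(1,2)]]
      is_geodesic_dist_add[OF metric_tree_geodesic[OF X mem(2,3)]] by auto
  moreover have "mdist X x p + mdist X p z = mdist X x z"
    using is_geodesic_dist_add[OF metric_tree_geodesic[OF X mem(1,3)] p] .
  ultimately show ?thesis
    using xp by (auto simp: gromov_product_def mdist_commute)
qed

text \<open>Let \<open>m\<close> and \<open>k\<close> be the feet of \<open>y\<close> and
  \<open>w\<close> on \<open>[xz]\<close>; by \<open>le\<close>, \<open>m\<close> does not come
  after \<open>k\<close> as seen from \<open>x\<close>. The path from \<open>y\<close> through
  \<open>m\<close> and \<open>k\<close> to \<open>w\<close> has length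
  \<open>mdist X x w + mdist X y z - mdist X x z\<close>.\<close>

lemma metric_tree_four_point_aux:
  assumes X: "metric_tree X"
    and mem: "x \<in> mspace X" "y \<in> mspace X" "z \<in> mspace X" "w \<in> mspace X"
    and le: "gromov_product X x y z \<le> gromov_product X x w z"
  shows "mdist X x z + mdist X y w \<le> mdist X x w + mdist X y z"
proof -
  obtain \<gamma> a b where g: "a \<le> b" "b - a = mdist X x z" "\<gamma> \<in> {a..b} \<rightarrow> mspace X"
      "\<forall>s\<in>{a..b}. \<forall>t\<in>{a..b}. mdist X (\<gamma> s) (\<gamma> t) = dist s t"
      "\<gamma> a = x" "\<gamma> b = z" "geodesic_segment X x z = \<gamma> ` {a..b}"
    using metric_tree_geodesic[OF X mem(1,3)] unfolding is_geodesic_def by blast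
  have foot: "a + gromov_product X x u z \<in> {a..b} \<and>
      mdist X (\<gamma> (a + gromov_product X x u z)) u = gromov_product X u x z"
    if u: "u \<in> mspace X" for u
  proof -
    let ?t = "a + gromov_product X x u z"
    have "gromov_product X x u z \<le> mdist X x z"
      using mdist_triangle[of x X z u] u mem by (simp add: gromov_product_def mdist_commute)
    then have t: "?t \<in> {a..b}"
      using gromov_product_nonneg[of x X u z] u mem g(2) by simp
    have "mdist X (\<gamma> a) (\<gamma> ?t) = dist a ?t"
      using g(1,4) t by auto
    then have "mdist X x (\<gamma> ?t) = gromov_product X x u z"
      using g(5) t by (simp add: dist_real_def)
    then show ?thesis
      using metric_tree_dist_to_geodesic[OF X mem(1) u mem(3), of "\<gamma> ?t"] t g(7) by auto
  qed
  define m where "m = \<gamma> (a + gromov_product X x y z)"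
  define k where "k = \<gamma> (a + gromov_product X x w z)"
  have "m \<in> mspace X" "k \<in> mspace X"
    using foot mem g(3) by (auto simp: m_def k_def)
  then have "mdist X y w \<le> mdist X y m + (mdist X m k + mdist X k w)"
    using mdist_triangle[of y X m w] mdist_triangle[of m X k w] mem by linarith
  also have "mdist X m k = gromov_product X x w z - gromov_product X x y z"
    using foot[of y] foot[of w] mem g(4) le by (auto simp: m_def k_def dist_real_def)
  also have "mdist X k w = gromov_product X w x z"
    using foot[of w] mem by (simp add: k_def)
  also have "mdist X y m = gromov_product X y x z"
    using foot[of y] mem by (simp add: m_def mdist_commute)
  finally show ?thesis
    by (simp add: gromov_product_def mdist_commute field_simps)
qed

lemma metric_tree_four_point:
  assumes X: "metric_tree X"
    and mem: "x \<in> mspace X" "y \<in> mspace X" "z \<in> mspace X" "w \<in> mspace X"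
  shows "mdist X x z + mdist X y w
    \<le> max (mdist X x y + mdist X z w) (mdist X x w + mdist X y z)"
  using metric_tree_four_point_aux[OF X mem] metric_tree_four_point_aux[OF X mem(1,4,3,2)]
  by (smt (verit) mdist_commute)

section \<open>Four-point pseudometrics\<close>

text \<open>The distance lives on labels instead of points, because the six points may
  coincide.\<close>

locale four_point_pseudometric =
  fixes d :: "'v \<Rightarrow> 'v \<Rightarrow> real"
  assumes self: "d a a = 0"
    and commute: "d a b = d b a"
    and four_point: "d a c + d b e \<le> max (d a b + d c e) (d a e + d b c)"

lemma metric_tree_four_point_pseudometric:
  assumes "metric_tree X" and "\<And>i. v i \<in> mspace X"
  shows "four_point_pseudometric (\<lambda>i j. mdist X (v i) (v j))"
proof
  show "mdist X (v a) (v c) + mdist X (v b) (v e)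
      \<le> max (mdist X (v a) (v b) + mdist X (v c) (v e))
          (mdist X (v a) (v e) + mdist X (v b) (v c))" for a b c e
    by (rule metric_tree_four_point) (fact assms)+
qed (simp_all add: assms mdist_commute)

definition O3_planar :: "('v \<Rightarrow> 'v \<Rightarrow> real) \<Rightarrow> 'v \<Rightarrow> 'v \<Rightarrow> 'v \<Rightarrow> 'v \<Rightarrow> 'v \<Rightarrow> 'v \<Rightarrow> bool" where
  "O3_planar d x x' y y' z z' \<longleftrightarrow>
     (\<exists>X X' Y Y' Z Z' :: complex.
        dist X X' \<ge> d x x' \<and> dist Y Y' \<ge> d y y' \<and> dist Z Z' \<ge> d z z' \<and>
        dist X Y \<le> d x y \<and> dist X Y' \<le> d x y' \<and> dist X Z \<le> d x z \<and> dist X Z' \<le> d x z' \<and>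
        dist X' Y \<le> d x' y \<and> dist X' Y' \<le> d x' y' \<and> dist X' Z \<le> d x' z \<and> dist X' Z' \<le> d x' z' \<and>
        dist Y Z \<le> d y z \<and> dist Y Z' \<le> d y z' \<and> dist Y' Z \<le> d y' z \<and> dist Y' Z' \<le> d y' z')"

section \<open>Plane geometry for the tripod case\<close>

lemma triangle_with_tangent_lengths:
  fixes \<alpha> \<beta> \<gamma> :: real
  assumes pos: "\<alpha> > 0" "\<beta> > 0" "\<gamma> > 0"
  obtains A B C :: complex
  where "dist A B = \<alpha> + \<beta>" "dist B C = \<beta> + \<gamma>" "dist A C = \<alpha> + \<gamma>"
proof
  \<comment> \<open>\<open>A\<close> is the origin and \<open>B\<close> is \<sigma> on the real
    axis. The law of cosines gives the real part \<open>u\<close> of \<open>C\<close>; Heron's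
    formula with semiperimeter \<open>\<sigma> + \<gamma>\<close> gives the squared altitude
    \<open>h\<close>.\<close>
  define \<sigma> where "\<sigma> = \<alpha> + \<beta>"
  define u where "u = \<alpha> + \<gamma> * (2 * \<alpha> - \<sigma>) / \<sigma>"
  define h where "h = 4 * (\<alpha> * (\<sigma> - \<alpha>) * \<gamma> * (\<sigma> + \<gamma>)) / \<sigma>\<^sup>2"
  have \<sigma>: "\<sigma> > 0" "\<beta> = \<sigma> - \<alpha>" "\<sigma> > \<alpha>"
    using pos by (simp_all add: \<sigma>_def)
  have h: "0 \<le> h"
    using pos \<sigma> by (simp add: h_def)
  have AC: "u\<^sup>2 + h = (\<alpha> + \<gamma>)\<^sup>2"
    unfolding u_def h_def using \<sigma>(1) by (simp add: divide_simps) algebra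
  have "(\<sigma> - u)\<^sup>2 + h = (\<sigma> - \<alpha> + \<gamma>)\<^sup>2"
    unfolding u_def h_def using \<sigma>(1) by (simp add: divide_simps) algebra
  then have BC: "(\<alpha> + \<beta> - u)\<^sup>2 + h = (\<beta> + \<gamma>)\<^sup>2"
    by (simp add: \<sigma>(2))
  show "dist 0 (complex_of_real (\<alpha> + \<beta>)) = \<alpha> + \<beta>"
    using pos by (simp add: dist_norm del: of_real_add)
  show "dist (complex_of_real (\<alpha> + \<beta>)) (Complex u (sqrt h)) = \<beta> + \<gamma>"
    using BC h pos by (simp add: dist_norm cmod_def)
  show "dist 0 (Complex u (sqrt h)) = \<alpha> + \<gamma>"
    using AC h pos by (simp add: dist_norm cmod_def)
qed

lemma segment_extension:
  fixes A B :: "'a :: real_normed_vector"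
  assumes "A \<noteq> B" "0 \<le> p" "0 \<le> q"
  obtains P Q where "dist P A = p" "dist Q B = q" "dist P Q = p + dist A B + q"
proof
  define e where "e = (B - A) /\<^sub>R dist A B"
  have e: "norm e = 1" "B = A + dist A B *\<^sub>R e"
    using assms by (simp_all add: e_def dist_norm norm_minus_commute)
  show "dist (A - p *\<^sub>R e) A = p" "dist (B + q *\<^sub>R e) B = q"
    using assms e(1) by (simp_all add: dist_norm)
  have "(A - p *\<^sub>R e) - (B + q *\<^sub>R e) = - ((p + dist A B + q) *\<^sub>R e)"
    by (subst e(2)) (simp add: algebra_simps)
  then have "dist (A - p *\<^sub>R e) (B + q *\<^sub>R e) = \<bar>p + dist A B + q\<bar>"
    by (simp only: dist_norm norm_minus_cancel norm_scaleR e(1) mult_1_right)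
  then show "dist (A - p *\<^sub>R e) (B + q *\<^sub>R e) = p + dist A B + q"
    using assms by simp
qed

context four_point_pseudometric
begin

lemma triangle: "d a c \<le> d a b + d b c"
  using four_point[of a c b b] by (simp add: self commute)

text \<open>Among the three sums over the pairings of four points, the two largest coincide; the
  hypothesis says that \<open>d a e + d b c\<close> is not one of them.\<close>

lemma four_point_eq:
  assumes "d a c + d b e > d a e + d b c"
  shows "d a c + d b e = d a b + d c e"
  using four_point[of a c b e] four_point[of a b c e] assms by (auto simp: commute)

section \<open>Aligned geodesics: placement on a line\<close>

text \<open>In the tree spanned by the six points, \<^term>\<open>d x x' + d y y' \<le> d x' y + d x y'\<close> says that the
  geodesics from \<open>x\<close> to \<open>x'\<close> and from \<open>y\<close> to \<open>y'\<close> run in the same direction along their overlap,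
  if any.\<close>

lemma aligned_triple:
  assumes "d x x' + d y y' \<le> d x' y + d x y'"
    and "d y y' + d z z' \<le> d y' z + d y z'"
    and "d z z' + d x x' \<le> d z' x + d z x'"
  shows "d x x' + d y y' + d z z' \<le> d x' y + d y' z + d z' x"
  by (smt (verit, best) assms commute four_point_eq)

text \<open>Place \<open>x\<close> at 0, \<open>x'\<close> at \<open>d x x'\<close>,
  \<open>y\<close> at \<open>t\<close> and \<open>y'\<close> at \<open>t + d y y'\<close>. The
  hypotheses are the upper bounds for the signed differences from \<open>y\<close> to
  \<open>x'\<close> and from \<open>x\<close> to \<open>y'\<close>; triangle inequalities give all
  the others.\<close>

lemma aligned_pair:
  assumes "d x x' - d x' y \<le> t" "t \<le> d x y' - d y y'"
  shows "\<bar>t\<bar> \<le> d x y" "\<bar>t + d y y'\<bar> \<le> d x y'"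
    "\<bar>d x x' - t\<bar> \<le> d x' y" "\<bar>d x x' - (t + d y y')\<bar> \<le> d x' y'"
  using assms triangle[of x y' y] triangle[of x' y x] triangle[of x y y'] triangle[of x y' x']
    triangle[of x' y' y] triangle[of x' y y'] commute[of x' x] commute[of y' y]
  by linarith+

lemma O3_planar_aligned:
  assumes xy: "d x x' + d y y' \<le> d x' y + d x y'"
    and yz: "d y y' + d z z' \<le> d y' z + d y z'"
    and zx: "d z z' + d x x' \<le> d z' x + d z x'"
  shows "O3_planar d x x' y y' z z'"
proof -
  have xyz: "d x x' + d y y' + d z z' \<le> d x' y + d y' z + d z' x"
    using aligned_triple[OF xy yz zx] .
  have xzy: "d x x' + d y y' + d z z' \<le> d x y' + d y z' + d z x'"
    using aligned_triple[of x x' z z' y y'] xy yz zx by (simp add: commute)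
  \<comment> \<open>The offsets \<open>s\<close> of \<open>y\<close> and \<open>r\<close> of
    \<open>z\<close> must satisfy lower and upper bounds on \<open>s\<close>, \<open>r\<close> and
    \<open>r - s\<close>. Both are chosen least: \<open>s\<close> respects its own lower bound and
    the one forced through \<open>r\<close>, and \<open>r\<close> respects its own and the one
    forced by \<open>s\<close>. The pairwise hypotheses together with \<open>xyz\<close> and
    \<open>xzy\<close> keep them below the upper bounds.\<close>
  define s where "s = max (d x x' - d x' y) (d x x' - d x' z - (d y z' - d z z'))"
  define r where "r = max (d x x' - d x' z) (s + d y y' - d y' z)"
  have s: "d x x' - d x' y \<le> s" "s \<le> d x y' - d y y'"
    using xy xzy by (auto simp: s_def commute)
  have r: "d x x' - d x' z \<le> r" "r \<le> d x z' - d z z'"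
    using zx xyz xy yz by (auto simp: r_def s_def commute)
  have rs: "d y y' - d y' z \<le> r - s" "r - s \<le> d y z' - d z z'"
    using yz by (auto simp: r_def s_def commute)
  note bounds = aligned_pair[OF s] aligned_pair[OF r] aligned_pair[OF rs]
  show ?thesis
    unfolding O3_planar_def
  proof (intro exI)
    let ?X = "0 :: real" and ?X' = "d x x'" and ?Y = s and ?Y' = "s + d y y'"
      and ?Z = r and ?Z' = "r + d z z'"
    show "dist (complex_of_real ?X) (of_real ?X') \<ge> d x x' \<and>
        dist (complex_of_real ?Y) (of_real ?Y') \<ge> d y y' \<and>
        dist (complex_of_real ?Z) (of_real ?Z') \<ge> d z z' \<and>
        dist (complex_of_real ?X) (of_real ?Y) \<le> d x y \<and>
        dist (complex_of_real ?X) (of_real ?Y') \<le> d x y' \<and>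
        dist (complex_of_real ?X) (of_real ?Z) \<le> d x z \<and>
        dist (complex_of_real ?X) (of_real ?Z') \<le> d x z' \<and>
        dist (complex_of_real ?X') (of_real ?Y) \<le> d x' y \<and>
        dist (complex_of_real ?X') (of_real ?Y') \<le> d x' y' \<and>
        dist (complex_of_real ?X') (of_real ?Z) \<le> d x' z \<and>
        dist (complex_of_real ?X') (of_real ?Z') \<le> d x' z' \<and>
        dist (complex_of_real ?Y) (of_real ?Z) \<le> d y z \<and>
        dist (complex_of_real ?Y) (of_real ?Z') \<le> d y z' \<and>
        dist (complex_of_real ?Y') (of_real ?Z) \<le> d y' z \<and>
        dist (complex_of_real ?Y') (of_real ?Z') \<le> d y' z'"
      using bounds by (simp del: of_real_add add: abs_le_iff dist_real_def abs_ge_self algebra_simps)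
  qed
qed

section \<open>Opposed geodesics: placement on an extended triangle\<close>

text \<open>If the three geodesics are pairwise opposed, the tree is a tripod with legs \<open>\<alpha>\<close>, \<open>\<beta>\<close>, \<open>\<gamma>\<close>, each of
  which ends in two pendant edges. The assumption \<open>cherries\<close> selects, of the two possible pairings of
  the points at the ends of the legs, the one with \<open>x, z'\<close> and \<open>y, x'\<close> and \<open>z, y'\<close>.\<close>

lemma snowflake_pendants:
  assumes xy: "d x x' + d y y' > d x' y + d x y'"
    and yz: "d y y' + d z z' > d y' z + d y z'"
    and zx: "d z z' + d x x' > d z' x + d z x'"
    and cherries: "d x z' + d y x' + d z y' \<le> d x y' + d y z' + d z x'"
  defines "\<alpha> \<equiv> (d z z' + d x x' - d z' x - d z x') / 2"
    and "\<beta> \<equiv> (d x x' + d y y' - d x' y - d x y') / 2"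
    and "px \<equiv> (d x x' + d x z' - d x' z') / 2"
    and "px' \<equiv> (d x' x + d x' y - d x y) / 2"
    and "py \<equiv> (d y y' + d y x' - d y' x') / 2"
    and "pz' \<equiv> (d z' z + d z' x - d z x) / 2"
  shows "px + pz' = d x z'" "px + (\<alpha> + \<beta>) + px' = d x x'" "px + (\<alpha> + \<beta>) + py = d x y"
    "pz' + (\<alpha> + \<beta>) + px' = d x' z'" "pz' + (\<alpha> + \<beta>) + py = d y z'"
proof -
  note sym = commute[of x' x] commute[of y' y] commute[of z' z] commute[of z' x]
    commute[of z x] commute[of z' x'] commute[of y x'] commute[of y' x'] commute[of z x']
    commute[of z' y] commute[of z' y'] commute[of z y'] commute[of z y] commute[of y' x] commute[of y x]
  have e1: "d x x' + d y y' = d x y + d x' y'"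
    using four_point_eq[of x y' y x'] xy sym by linarith
  have e3: "d z z' + d x x' = d z x + d z' x'"
    using four_point_eq[of z x' x z'] zx sym by linarith
  note q = four_point[of x x' z z'] four_point[of x z y' z'] four_point[of x' y' z z']
    four_point[of y y' z z'] four_point[of x' z y' z']
  \<comment> \<open>In the tripod, \<open>z, y'\<close> are separated from \<open>x, x'\<close>, so
    the two sums across this separation agree; \<open>b\<close> says the same of
    \<open>y, x'\<close> against \<open>y', z'\<close>. Given \<open>e1\<close>, \<open>e3\<close>,
    \<open>a\<close> and \<open>b\<close>, all five claims are linear.\<close>
  have a: "d z x + d x' y' = d z x' + d x y'"
  proof (rule antisym)
    show "d z x + d x' y' \<le> d z x' + d x y'"
      using xy yz zx cherries q four_point[of x' z' y z] sym by (smt (verit))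
    show "d z x' + d x y' \<le> d z x + d x' y'"
      using xy yz zx cherries q four_point[of x y' z z'] four_point[of x' z' y z] sym by (smt (verit))
  qed
  have b: "d z' x' + d y y' = d x' y' + d y z'"
  proof (rule antisym)
    show "d z' x' + d y y' \<le> d x' y' + d y z'"
      using xy yz zx cherries q four_point[of x' z' y z] sym by (smt (verit))
    show "d x' y' + d y z' \<le> d z' x' + d y y'"
      using xy yz zx cherries q four_point[of x' z y z'] four_point[of y z y' z'] sym by (smt (verit))
  qed
  show "px + pz' = d x z'"
    using e1 e3 a b unfolding assms(5-) sym by argo
  show "px + (\<alpha> + \<beta>) + px' = d x x'"
    using e1 e3 a b unfolding assms(5-) sym by argo
  show "px + (\<alpha> + \<beta>) + py = d x y"
    using e1 e3 a b unfolding assms(5-) sym by argo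
  show "pz' + (\<alpha> + \<beta>) + px' = d x' z'"
    using e1 e3 a b unfolding assms(5-) sym by argo
  show "pz' + (\<alpha> + \<beta>) + py = d y z'"
    using e1 e3 a b unfolding assms(5-) sym by argo
qed

lemma O3_planar_snowflake:
  assumes xy: "d x x' + d y y' > d x' y + d x y'"
    and yz: "d y y' + d z z' > d y' z + d y z'"
    and zx: "d z z' + d x x' > d z' x + d z x'"
    and cherries: "d x z' + d y x' + d z y' \<le> d x y' + d y z' + d z x'"
  shows "O3_planar d x x' y y' z z'"
proof -
  define \<alpha> where "\<alpha> = (d z z' + d x x' - d z' x - d z x') / 2"
  define \<beta> where "\<beta> = (d x x' + d y y' - d x' y - d x y') / 2"
  define \<gamma> where "\<gamma> = (d y y' + d z z' - d y' z - d y z') / 2"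
  \<comment> \<open>Each pendant length is the Gromov product, based at the point itself, of its
    opposite point and of its partner at the end of the same leg.\<close>
  define px where "px = (d x x' + d x z' - d x' z') / 2"
  define px' where "px' = (d x' x + d x' y - d x y) / 2"
  define py where "py = (d y y' + d y x' - d y' x') / 2"
  define py' where "py' = (d y' y + d y' z - d y z) / 2"
  define pz where "pz = (d z z' + d z y' - d z' y') / 2"
  define pz' where "pz' = (d z' z + d z' x - d z x) / 2"
  note defs = \<alpha>_def \<beta>_def \<gamma>_def px_def px'_def py_def py'_def pz_def pz'_def
  have AB: "px + pz' = d x z'" "px + (\<alpha> + \<beta>) + px' = d x x'" "px + (\<alpha> + \<beta>) + py = d x y"
      "pz' + (\<alpha> + \<beta>) + px' = d x' z'" "pz' + (\<alpha> + \<beta>) + py = d y z'"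
    using snowflake_pendants[OF xy yz zx cherries] unfolding defs by auto
  \<comment> \<open>The cyclic shift of the three pairs preserves the hypotheses and carries
    \<alpha>, \<beta>, \<gamma> to \<beta>, \<gamma>, \<alpha>.\<close>
  have BC: "py + px' = d y x'" "py + (\<beta> + \<gamma>) + py' = d y y'" "py + (\<beta> + \<gamma>) + pz = d y z"
      "px' + (\<beta> + \<gamma>) + py' = d y' x'" "px' + (\<beta> + \<gamma>) + pz = d z x'"
    using snowflake_pendants[OF yz zx xy] cherries unfolding defs by (simp_all only: add_ac)
  have CA: "pz + py' = d z y'" "pz + (\<gamma> + \<alpha>) + pz' = d z z'" "pz + (\<gamma> + \<alpha>) + px = d z x"
      "py' + (\<gamma> + \<alpha>) + pz' = d z' y'" "py' + (\<gamma> + \<alpha>) + px = d x y'"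
    using snowflake_pendants[OF zx xy yz] cherries unfolding defs by (simp_all only: add_ac)
  have pos: "\<alpha> > 0" "\<beta> > 0" "\<gamma> > 0"
    using xy yz zx by (simp_all add: defs)
  have nonneg: "0 \<le> px" "0 \<le> px'" "0 \<le> py" "0 \<le> py'" "0 \<le> pz" "0 \<le> pz'"
    using triangle[of x' z' x] triangle[of x y x'] triangle[of y' x' y] triangle[of y z y']
      triangle[of z' y' z] triangle[of z x z'] by (simp_all add: defs commute)
  obtain A B C :: complex
    where sides: "dist A B = \<alpha> + \<beta>" "dist B C = \<beta> + \<gamma>" "dist A C = \<alpha> + \<gamma>"
    using triangle_with_tangent_lengths[OF pos] .
  then have "A \<noteq> B" "B \<noteq> C" "C \<noteq> A"
    using pos by auto
  obtain X X' where X: "dist X A = px" "dist X' B = px'" "dist X X' = px + dist A B + px'"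
    using segment_extension[OF \<open>A \<noteq> B\<close> nonneg(1,2)] .
  obtain Y Y' where Y: "dist Y B = py" "dist Y' C = py'" "dist Y Y' = py + dist B C + py'"
    using segment_extension[OF \<open>B \<noteq> C\<close> nonneg(3,4)] .
  obtain Z Z' where Z: "dist Z C = pz" "dist Z' A = pz'" "dist Z Z' = pz + dist C A + pz'"
    using segment_extension[OF \<open>C \<noteq> A\<close> nonneg(5,6)] .
  \<comment> \<open>\<open>A\<close> carries the pendants of \<open>x, z'\<close>, \<open>B\<close>
    those of \<open>y, x'\<close> and \<open>C\<close> those of \<open>z, y'\<close>. A pair at
    different vertices is joined by two pendants and a side, whose total length is exactly the given
    distance.\<close>
  have path: "dist P Q \<le> dist P U + dist U V + dist Q V" for P Q U V :: complex
    using dist_triangle[of P Q U] dist_triangle[of U Q V] by (simp add: dist_commute)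
  have opposite: "d x x' \<le> dist X X'" "d y y' \<le> dist Y Y'" "d z z' \<le> dist Z Z'"
    using X(3) Y(3) Z(3) sides AB(2) BC(2) CA(2) by (simp_all add: dist_commute)
  have near: "dist X Z' \<le> d x z'" "dist X' Y \<le> d x' y" "dist Y' Z \<le> d y' z"
    using dist_triangle2[of X Z' A] dist_triangle2[of X' Y B] dist_triangle2[of Y' Z C]
      X Y Z AB(1) BC(1) CA(1) by (simp_all add: commute)
  have across_AB: "dist X Y \<le> d x y" "dist X' Z' \<le> d x' z'" "dist Y Z' \<le> d y z'"
    using path[of X Y A B] path[of Z' X' A B] path[of Z' Y A B] X Y Z sides AB
    by (simp_all add: dist_commute)
  have across_BC: "dist Y Z \<le> d y z" "dist X' Y' \<le> d x' y'" "dist X' Z \<le> d x' z"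
    using path[of Y Z B C] path[of X' Y' B C] path[of X' Z B C] X Y Z sides BC
    by (simp_all add: dist_commute commute)
  have across_CA: "dist X Z \<le> d x z" "dist Y' Z' \<le> d y' z'" "dist X Y' \<le> d x y'"
    using path[of X Z A C] path[of Z' Y' A C] path[of X Y' A C] X Y Z sides CA
    by (simp_all add: dist_commute commute)
  show ?thesis
    unfolding O3_planar_def
    using opposite near across_AB across_BC across_CA by blast
qed

section \<open>Symmetries and the choice of orientations\<close>

lemma O3_planar_swap_y:
  assumes "O3_planar d x x' y' y z z'"
  shows "O3_planar d x x' y y' z z'"
proof -
  obtain X X' Y Y' Z Z' :: complex where w:
    "dist X X' \<ge> d x x'" "dist Y Y' \<ge> d y' y" "dist Z Z' \<ge> d z z'"
    "dist X Y \<le> d x y'" "dist X Y' \<le> d x y" "dist X Z \<le> d x z"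
    "dist X Z' \<le> d x z'" "dist X' Y \<le> d x' y'" "dist X' Y' \<le> d x' y"
    "dist X' Z \<le> d x' z" "dist X' Z' \<le> d x' z'" "dist Y Z \<le> d y' z"
    "dist Y Z' \<le> d y' z'" "dist Y' Z \<le> d y z" "dist Y' Z' \<le> d y z'"
    using assms unfolding O3_planar_def by blast
  show ?thesis
    unfolding O3_planar_def
    by (rule exI[of _ X], rule exI[of _ X'], rule exI[of _ Y'], rule exI[of _ Y], rule exI[of _ Z], rule exI[of _ Z'])
      (use w in \<open>simp add: commute dist_commute\<close>)
qed

lemma O3_planar_swap_z:
  assumes "O3_planar d x x' y y' z' z"
  shows "O3_planar d x x' y y' z z'"
proof -
  obtain X X' Y Y' Z Z' :: complex where w:
    "dist X X' \<ge> d x x'" "dist Y Y' \<ge> d y y'" "dist Z Z' \<ge> d z' z"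
    "dist X Y \<le> d x y" "dist X Y' \<le> d x y'" "dist X Z \<le> d x z'"
    "dist X Z' \<le> d x z" "dist X' Y \<le> d x' y" "dist X' Y' \<le> d x' y'"
    "dist X' Z \<le> d x' z'" "dist X' Z' \<le> d x' z" "dist Y Z \<le> d y z'"
    "dist Y Z' \<le> d y z" "dist Y' Z \<le> d y' z'" "dist Y' Z' \<le> d y' z"
    using assms unfolding O3_planar_def by blast
  show ?thesis
    unfolding O3_planar_def
    by (rule exI[of _ X], rule exI[of _ X'], rule exI[of _ Y], rule exI[of _ Y'], rule exI[of _ Z'], rule exI[of _ Z])
      (use w in \<open>simp add: commute dist_commute\<close>)
qed

lemma O3_planar_swap_yz:
  assumes "O3_planar d x x' z z' y y'"
  shows "O3_planar d x x' y y' z z'"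
proof -
  obtain X X' Y Y' Z Z' :: complex where w:
    "dist X X' \<ge> d x x'" "dist Y Y' \<ge> d z z'" "dist Z Z' \<ge> d y y'"
    "dist X Y \<le> d x z" "dist X Y' \<le> d x z'" "dist X Z \<le> d x y"
    "dist X Z' \<le> d x y'" "dist X' Y \<le> d x' z" "dist X' Y' \<le> d x' z'"
    "dist X' Z \<le> d x' y" "dist X' Z' \<le> d x' y'" "dist Y Z \<le> d z y"
    "dist Y Z' \<le> d z y'" "dist Y' Z \<le> d z' y" "dist Y' Z' \<le> d z' y'"
    using assms unfolding O3_planar_def by blast
  show ?thesis
    unfolding O3_planar_def
    by (rule exI[of _ X], rule exI[of _ X'], rule exI[of _ Z], rule exI[of _ Z'], rule exI[of _ Y], rule exI[of _ Y'])
      (use w in \<open>simp add: commute dist_commute\<close>)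
qed

text \<open>Exchanging the pairs \<open>y, y'\<close> and \<open>z, z'\<close> keeps the three
  geodesics opposed and exchanges the two sides of the \<open>cherries\<close> inequality.\<close>

lemma O3_planar_opposed:
  assumes "d x x' + d y y' > d x' y + d x y'"
    and "d y y' + d z z' > d y' z + d y z'"
    and "d z z' + d x x' > d z' x + d z x'"
  shows "O3_planar d x x' y y' z z'"
proof (cases "d x z' + d y x' + d z y' \<le> d x y' + d y z' + d z x'")
  case True
  then show ?thesis using O3_planar_snowflake assms by blast
next
  case False
  have "O3_planar d x x' z z' y y'"
    by (rule O3_planar_snowflake) (use assms False in \<open>simp_all add: commute\<close>)
  then show ?thesis by (rule O3_planar_swap_yz)
qed

text \<open>Reversing one geodesic flips its orientation relative to both others, and each two
  geodesics are aligned in at least one relative orientation (\<open>some\<close>). If some two are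
  aligned in both, the rest can be oriented to fit. Otherwise the relative orientations are forced,
  and a parity argument over the four orientations of \<open>y, y'\<close> and \<open>z, z'\<close>
  yields either all pairs aligned or none.\<close>

lemma O3_planar: "O3_planar d x x' y y' z z'"
proof -
  define aligned where "aligned = (\<lambda>a a' b b'. d a a' + d b b' \<le> d a' b + d a b')"
  have flip: "aligned a' a b b' \<longleftrightarrow> aligned a a' b' b" "aligned b b' a a' \<longleftrightarrow> aligned a a' b b'"
    for a a' b b'
    by (auto simp: aligned_def commute algebra_simps)
  have some: "aligned a a' b b' \<or> aligned a a' b' b" for a a' b b'
    using four_point[of a a' b b'] by (auto simp: aligned_def commute max_def split: if_splits)
  have good: "O3_planar d x x' b b' c c'"
    if "aligned x x' b b' \<and> aligned b b' c c' \<and> aligned c c' x x' \<or>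
        \<not> aligned x x' b b' \<and> \<not> aligned b b' c c' \<and> \<not> aligned c c' x x'" for b b' c c'
    using that O3_planar_aligned O3_planar_opposed unfolding aligned_def by (meson not_le)
  have "aligned y' y z z' = aligned y y' z' z" "aligned y' y z' z = aligned y y' z z'"
    "aligned z z' x x' = aligned x x' z z'" "aligned z' z x x' = aligned x x' z' z"
    using flip by blast+
  then consider "O3_planar d x x' y y' z z'" | "O3_planar d x x' y' y z z'"
    | "O3_planar d x x' y y' z' z" | "O3_planar d x x' y' y z' z"
    using good[of y y' z z'] good[of y' y z z'] good[of y y' z' z] good[of y' y z' z]
      some[of x x' y y'] some[of y y' z z'] some[of x x' z z'] by argo
  then show ?thesis
    using O3_planar_swap_y O3_planar_swap_z by cases blast+
qed

end

section \<open>Orthogonal sums in the Hilbert space\<close>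

lemma ell2_of_complex_family:
  fixes I :: "nat set"
  assumes "finite I"
  obtains \<Phi> :: "(nat \<Rightarrow> complex) \<Rightarrow> ell2"
  where "\<And>u v. dist (\<Phi> u) (\<Phi> v) = sqrt (\<Sum>i\<in>I. (dist (u i) (v i))\<^sup>2)"
proof
  \<comment> \<open>The plane of index \<open>i\<close> occupies the coordinates
    \<open>2 * i\<close> (real part) and \<open>2 * i + 1\<close> (imaginary part); all coordinates
    outside these planes are 0.\<close>
  define f :: "(nat \<Rightarrow> complex) \<Rightarrow> nat \<Rightarrow> real" where
    "f u k = (if k div 2 \<in> I then if even k then Re (u (k div 2)) else Im (u (k div 2)) else 0)" for u k
  fix u v :: "nat \<Rightarrow> complex"
  obtain N where N: "I \<subseteq> {..<N}"
    using assms finite_nat_iff_bounded by blast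
  have zero: "f w k = 0" if "k \<notin> {..<N * 2}" for w k
    using that N by (auto simp: f_def)
  have "summable (\<lambda>k. (f w k)\<^sup>2)" for w
    by (rule summable_finite[of "{..<N * 2}"]) (simp_all add: zero)
  then have nth: "ell2_nth (Abs_ell2 (f w)) = f w" for w
    by (simp add: Abs_ell2_inverse)
  have "(\<Sum>k. (f u k - f v k)\<^sup>2) = (\<Sum>k<N * 2. (f u k - f v k)\<^sup>2)"
    by (rule suminf_finite) (simp_all add: zero)
  also have "\<dots> = (\<Sum>i<N. \<Sum>k\<in>{i * 2..<i * 2 + 2}. (f u k - f v k)\<^sup>2)"
    by (rule sum.nat_group[symmetric])
  also have "\<dots> = (\<Sum>i<N. if i \<in> I then (dist (u i) (v i))\<^sup>2 else 0)"
  proof (rule sum.cong)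
    fix i
    have "{i * 2..<i * 2 + 2} = {i * 2, Suc (i * 2)}" by auto
    then show "(\<Sum>k\<in>{i * 2..<i * 2 + 2}. (f u k - f v k)\<^sup>2) =
        (if i \<in> I then (dist (u i) (v i))\<^sup>2 else 0)"
      by (simp add: f_def dist_norm cmod_power2)
  qed simp
  also have "\<dots> = (\<Sum>i\<in>I. (dist (u i) (v i))\<^sup>2)"
    using N by (simp add: sum.If_cases Int_absorb1)
  finally show "dist (Abs_ell2 (f u)) (Abs_ell2 (f v)) = sqrt (\<Sum>i\<in>I. (dist (u i) (v i))\<^sup>2)"
    by (simp add: dist_ell2 nth)
qed

text \<open>Both the product metric and the orthogonal sum of the planes are roots of sums of
  squares, so inequalities in either direction pass from the factors to the product, for any
  graph.\<close>

lemma meets_comparison_l2_product: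
  fixes I :: "nat set" and T :: "nat \<Rightarrow> 'a metric"
  assumes "finite I"
    and planar: "\<And>i v. i \<in> I \<Longrightarrow> v \<in> V \<rightarrow> mspace (T i) \<Longrightarrow>
      \<exists>w :: 'v \<Rightarrow> complex. \<forall>a\<in>V. \<forall>b\<in>V. a \<noteq> b \<longrightarrow>
        (if {a, b} \<in> E then dist (w a) (w b) \<le> mdist (T i) (v a) (v b)
         else dist (w a) (w b) \<ge> mdist (T i) (v a) (v b))"
  shows "meets_comparison V E (l2_product I T)"
  unfolding meets_comparison_def
proof
  fix v assume v: "v \<in> V \<rightarrow> mspace (l2_product I T)"
  have "\<exists>w :: 'v \<Rightarrow> complex. \<forall>a\<in>V. \<forall>b\<in>V. a \<noteq> b \<longrightarrow>
        (if {a, b} \<in> E then dist (w a) (w b) \<le> mdist (T i) (v a i) (v b i)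
         else dist (w a) (w b) \<ge> mdist (T i) (v a i) (v b i))" if "i \<in> I" for i
    using planar[OF that, of "\<lambda>a. v a i"] v that assms(1) by (auto simp: Pi_iff PiE_iff)
  then obtain w :: "nat \<Rightarrow> 'v \<Rightarrow> complex" where w: "\<And>i a b. i \<in> I \<Longrightarrow> a \<in> V \<Longrightarrow> b \<in> V \<Longrightarrow> a \<noteq> b \<Longrightarrow>
        (if {a, b} \<in> E then dist (w i a) (w i b) \<le> mdist (T i) (v a i) (v b i)
         else dist (w i a) (w i b) \<ge> mdist (T i) (v a i) (v b i))"
    by metis
  obtain \<Phi> :: "(nat \<Rightarrow> complex) \<Rightarrow> ell2"
    where \<Phi>: "\<And>u v. dist (\<Phi> u) (\<Phi> v) = sqrt (\<Sum>i\<in>I. (dist (u i) (v i))\<^sup>2)"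
    using ell2_of_complex_family[OF assms(1)] by blast
  show "\<exists>w :: 'v \<Rightarrow> ell2. \<forall>a\<in>V. \<forall>b\<in>V. a \<noteq> b \<longrightarrow>
        (if {a, b} \<in> E then dist (w a) (w b) \<le> mdist (l2_product I T) (v a) (v b)
         else dist (w a) (w b) \<ge> mdist (l2_product I T) (v a) (v b))"
  proof (intro exI[of _ "\<lambda>a. \<Phi> (\<lambda>i. w i a)"] ballI impI)
    fix a b assume ab: "a \<in> V" "b \<in> V" "a \<noteq> b"
    show "if {a, b} \<in> E
        then dist (\<Phi> (\<lambda>i. w i a)) (\<Phi> (\<lambda>i. w i b)) \<le> mdist (l2_product I T) (v a) (v b)
        else dist (\<Phi> (\<lambda>i. w i a)) (\<Phi> (\<lambda>i. w i b)) \<ge> mdist (l2_product I T) (v a) (v b)"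
      using w[OF _ ab] assms(1)
      by (auto simp: \<Phi> split: if_splits intro!: sum_mono power_mono)
  qed
qed

lemma metric_tree_O3_planar:
  fixes X :: "'a metric" and v :: "octahedron_vertex \<Rightarrow> 'a"
  assumes "metric_tree X" and "\<And>i. v i \<in> mspace X"
  shows "\<exists>w :: octahedron_vertex \<Rightarrow> complex. \<forall>i j. i \<noteq> j \<longrightarrow>
    (if {i, j} \<in> octahedron_edges then dist (w i) (w j) \<le> mdist X (v i) (v j)
     else dist (w i) (w j) \<ge> mdist X (v i) (v j))"
proof -
  have all: "(\<forall>i. P i) \<longleftrightarrow> P vx \<and> P vx' \<and> P vy \<and> P vy' \<and> P vz \<and> P vz'" for P
    by (metis octahedron_vertex.exhaust)
  have edge: "{i, j} \<in> octahedron_edges \<longleftrightarrow>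
      i \<noteq> j \<and> {i, j} \<noteq> {vx, vx'} \<and> {i, j} \<noteq> {vy, vy'} \<and> {i, j} \<noteq> {vz, vz'}" for i j
    by (auto simp: octahedron_edges_def doubleton_eq_iff)
  interpret four_point_pseudometric "\<lambda>i j. mdist X (v i) (v j)"
    using assms by (rule metric_tree_four_point_pseudometric)
  obtain x x' y y' z z' :: complex where w:
    "dist x x' \<ge> mdist X (v vx) (v vx') \<and> dist y y' \<ge> mdist X (v vy) (v vy') \<and>
     dist z z' \<ge> mdist X (v vz) (v vz') \<and>
     dist x y \<le> mdist X (v vx) (v vy) \<and> dist x y' \<le> mdist X (v vx) (v vy') \<and>
     dist x z \<le> mdist X (v vx) (v vz) \<and> dist x z' \<le> mdist X (v vx) (v vz') \<and>
     dist x' y \<le> mdist X (v vx') (v vy) \<and> dist x' y' \<le> mdist X (v vx') (v vy') \<and>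
     dist x' z \<le> mdist X (v vx') (v vz) \<and> dist x' z' \<le> mdist X (v vx') (v vz') \<and>
     dist y z \<le> mdist X (v vy) (v vz) \<and> dist y z' \<le> mdist X (v vy) (v vz') \<and>
     dist y' z \<le> mdist X (v vy') (v vz) \<and> dist y' z' \<le> mdist X (v vy') (v vz')"
    using O3_planar[of vx vx' vy vy' vz vz'] unfolding O3_planar_def by blast
  show ?thesis
    by (rule exI[of _ "case_octahedron_vertex x x' y y' z z'"])
      (use w in \<open>simp add: all edge doubleton_eq_iff dist_commute mdist_commute\<close>)
qed

theorem mainTheorem1:
  fixes n :: nat and T :: "nat \<Rightarrow> 'a metric"
  assumes "n \<ge> 1"
    and "\<And>i. i \<in> {1..n} \<Longrightarrow> metric_tree (T i)"
  shows "meets_O3_comparison (l2_product {1..n} T)"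
  unfolding meets_O3_comparison_def
proof (rule meets_comparison_l2_product)
  fix i and v :: "octahedron_vertex \<Rightarrow> 'a"
  assume "i \<in> {1..n}" "v \<in> UNIV \<rightarrow> mspace (T i)"
  then show "\<exists>w :: octahedron_vertex \<Rightarrow> complex. \<forall>a\<in>UNIV. \<forall>b\<in>UNIV. a \<noteq> b \<longrightarrow>
      (if {a, b} \<in> octahedron_edges then dist (w a) (w b) \<le> mdist (T i) (v a) (v b)
       else dist (w a) (w b) \<ge> mdist (T i) (v a) (v b))"
    using metric_tree_O3_planar[of "T i" v] assms(2) by (simp add: Pi_iff)
qed simp

end
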